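(* For every nontrivial abelian group $M$ there is an infinite antichain in the order $\preccurlyeq_M$ that consists of graphs with chromatic number at most $3$; that is, there are infinitely many graphs $G_0,G_1,G_2,\dots$, each of chromatic number at most $3$, such that $G_i\not\preccurlyeq_M G_j$ for all $i\neq j$.
   Context: Graphs are finite loopless directed graphs; the chromatic number is that of the underlying undirected graph. For a circuit $C$ of the underlying undirected graph, $C^+$ and $C^-$ denote the sets of its edges oriented in each of the two directions around $C$. An $M$-tension on $G$ is a function $\tau:E(G)\to M$ such that $\sum_{e\in C^+}\tau(e)=\sum_{e\in C^-}\tau(e)$ for every circuit $C$ of $G$. A mapping $f:E(G)\to E(H)$ is $M$-tension-continuous if for every $M$-tension $\tau$ on $H$ the composition $\tau\circ f$ is an $M$-tension on $G$. Write $G\preccurlyeq_M H$ if there is an $M$-tension-continuous mapping $E(G)\to E(H)$. *)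

theory Defs
  imports Complex_Main "Graph_Theory.Graph_Theory"
begin

text \<open>
  Finite loopless directed graphs are the digraphs satisfying \<open>finite_loopless_digraph\<close>;
  arcs have identities of their own, so parallel and antiparallel arcs are permitted.
\<close>

definition finite_loopless_digraph :: "('v, 'e) pre_digraph \<Rightarrow> bool" where
  "finite_loopless_digraph G \<longleftrightarrow> fin_digraph G \<and> loopfree_digraph G"

text \<open>
  The condition on a colouring does not depend on the orientation of the arcs, so this is the
  chromatic number of the underlying undirected graph. For a finite loopless digraph the set
  over which the least element is taken is nonempty.
\<close>

definition proper_coloring :: "('v, 'e) pre_digraph \<Rightarrow> nat \<Rightarrow> ('v \<Rightarrow> nat) \<Rightarrow> bool" where
  "proper_coloring G k c \<longleftrightarrow>
     c \<in> verts G \<rightarrow> {..<k} \<and> (\<forall>e\<in>arcs G. c (tail G e) \<noteq> c (head G e))"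

definition chromatic_number :: "('v, 'e) pre_digraph \<Rightarrow> nat" where
  "chromatic_number G = (LEAST k. \<exists>c. proper_coloring G k c)"

text \<open>
  In the following digraph, the arc \<open>(e, True)\<close> is the arc \<open>e\<close> of \<open>G\<close> traversed along its
  orientation, and \<open>(e, False)\<close> is \<open>e\<close> traversed against it. Walks in it are walks in the
  underlying undirected multigraph of \<open>G\<close>.
\<close>

definition traversal_digraph :: "('v, 'e) pre_digraph \<Rightarrow> ('v, 'e \<times> bool) pre_digraph" where
  "traversal_digraph G =
     \<lparr> verts = verts G,
       arcs = arcs G \<times> UNIV,
       tail = (\<lambda>(e, b). if b then tail G e else head G e),
       head = (\<lambda>(e, b). if b then head G e else tail G e) \<rparr>"

text \<open>
  A circuit of the underlying undirected graph is given by one of its cyclic traversals. The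
  condition \<open>distinct (map fst C)\<close> excludes going back and forth along a single edge; two
  different edges with the same ends do form a circuit.
\<close>

definition circuit :: "('v, 'e) pre_digraph \<Rightarrow> ('e \<times> bool) list \<Rightarrow> bool" where
  "circuit G C \<longleftrightarrow> pre_digraph.cycle (traversal_digraph G) C \<and> distinct (map fst C)"

definition circuit_pos :: "('e \<times> bool) list \<Rightarrow> 'e set" where
  "circuit_pos C = {e. (e, True) \<in> set C}"

definition circuit_neg :: "('e \<times> bool) list \<Rightarrow> 'e set" where
  "circuit_neg C = {e. (e, False) \<in> set C}"

text \<open>
  The group \<open>M\<close> is the type \<open>'m\<close>. Only the values of \<open>\<tau>\<close> on the arcs of \<open>G\<close> matter.
\<close>

definition tension :: "('v, 'e) pre_digraph \<Rightarrow> ('e \<Rightarrow> 'm::ab_group_add) \<Rightarrow> bool" where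
  "tension G \<tau> \<longleftrightarrow>
     (\<forall>C. circuit G C \<longrightarrow> (\<Sum>e\<in>circuit_pos C. \<tau> e) = (\<Sum>e\<in>circuit_neg C. \<tau> e))"

definition tension_continuous ::
    "'m::ab_group_add itself \<Rightarrow> ('v, 'e) pre_digraph \<Rightarrow> ('w, 'f) pre_digraph \<Rightarrow> ('e \<Rightarrow> 'f) \<Rightarrow> bool"
  where
  "tension_continuous M G H f \<longleftrightarrow>
     f \<in> arcs G \<rightarrow> arcs H \<and> (\<forall>\<tau> :: 'f \<Rightarrow> 'm. tension H \<tau> \<longrightarrow> tension G (\<tau> \<circ> f))"

definition tension_le ::
    "'m::ab_group_add itself \<Rightarrow> ('v, 'e) pre_digraph \<Rightarrow> ('w, 'f) pre_digraph \<Rightarrow> bool"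
  where
  "tension_le M G H \<longleftrightarrow> (\<exists>f. tension_continuous M G H f)"

end

theory Submission
  imports Defs "HOL-Library.Ramsey"
begin

text \<open>
  The antichain consists of products of the transitive triangle with shift digraphs on
  \<open>k\<close>-subsets of \<open>{..<N}\<close>, for rapidly growing \<open>k\<close> and \<open>N\<close>. Two facts pull against each other.
  Locally, such a product looks balanced: in a connected set of few arcs (compared to \<open>k\<close>) all
  vertices share an element \<open>t\<close>, and counting the elements above \<open>t\<close> gives a potential that rises
  by the same amount along each of these arcs. So any few arcs carry a constant tension \<open>x \<noteq> 0\<close>.
  Globally, it is not balanced: winding around the triangle moves a \<open>k\<close>-subset by one position,
  and two subsets can be joined by windings of lengths \<open>k\<close> and \<open>k + 1\<close>, so a tension that is
  constant on all arcs within a large subset of \<open>{..<N}\<close> vanishes there. Hence a map that takes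
  few values on those arcs is not tension-continuous. A map from an earlier graph to a later one
  takes few values because the earlier graph is small; a map from a later graph to an earlier one
  does so on the arcs within a large subset, by Ramsey's theorem.
\<close>

section \<open>Tensions and closed walks\<close>

definition walk_sum :: "('e \<Rightarrow> 'm::ab_group_add) \<Rightarrow> ('e \<times> bool) list \<Rightarrow> 'm" where
  "walk_sum \<tau> p = (\<Sum>(e, b)\<leftarrow>p. if b then \<tau> e else - \<tau> e)"

lemma walk_sum_simps [simp]:
  "walk_sum \<tau> [] = 0"
  "walk_sum \<tau> ((e, b) # p) = (if b then \<tau> e else - \<tau> e) + walk_sum \<tau> p"
  "walk_sum \<tau> (p @ q) = walk_sum \<tau> p + walk_sum \<tau> q"
  by (simp_all add: walk_sum_def)

lemma walk_sum_circuit: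
  assumes "distinct C"
  shows "walk_sum \<tau> C = (\<Sum>e\<in>circuit_pos C. \<tau> e) - (\<Sum>e\<in>circuit_neg C. \<tau> e)"
proof -
  let ?h = "\<lambda>(e, b). if b then \<tau> e else - \<tau> e"
  have fin: "finite (circuit_pos C)" "finite (circuit_neg C)"
    by (rule finite_subset[of _ "fst ` set C"]; force simp: circuit_pos_def circuit_neg_def)+
  have split: "set C = circuit_pos C \<times> {True} \<union> circuit_neg C \<times> {False}"
    by (auto simp: circuit_pos_def circuit_neg_def) (metis (full_types))+
  have "walk_sum \<tau> C = sum ?h (set C)"
    unfolding walk_sum_def using assms by (rule sum_list_distinct_conv_sum_set)
  also have "\<dots> = sum ?h (circuit_pos C \<times> {True}) + sum ?h (circuit_neg C \<times> {False})"
    unfolding split by (rule sum.union_disjoint) (use fin in auto)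
  also have "\<dots> = (\<Sum>e\<in>circuit_pos C. \<tau> e) - (\<Sum>e\<in>circuit_neg C. \<tau> e)"
    by (simp add: sum.cartesian_product' sum_negf)
  finally show ?thesis .
qed

lemma traversal_simps [simp]:
  "verts (traversal_digraph G) = verts G"
  "arcs (traversal_digraph G) = arcs G \<times> UNIV"
  "tail (traversal_digraph G) (e, b) = (if b then tail G e else head G e)"
  "head (traversal_digraph G) (e, b) = (if b then head G e else tail G e)"
  by (simp_all add: traversal_digraph_def)

lemma wf_traversal_digraph:
  "wf_digraph G \<Longrightarrow> wf_digraph (traversal_digraph G)"
  by (auto simp: wf_digraph_def)

text \<open>The differences telescope, because traversing an arc backwards flips the sign of its
  contribution.\<close>

lemma (in wf_digraph) walk_sum_potential_diff:
  assumes "\<And>e. e \<in> arcs G \<Longrightarrow> \<tau> e = p (head G e) - p (tail G e)"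
    and "pre_digraph.awalk (traversal_digraph G) u w v"
  shows "walk_sum \<tau> w = p v - p u"
proof -
  interpret T: wf_digraph "traversal_digraph G"
    using wf_digraph by (rule wf_traversal_digraph)
  show ?thesis
    using assms(2)
  proof (induction w arbitrary: u)
    case Nil
    then show ?case by (simp add: T.awalk_Nil_iff)
  next
    case (Cons a w)
    obtain e b where a: "a = (e, b)" by fastforce
    from Cons show ?case
      using assms(1)[of e] by (auto simp: a T.awalk_Cons_iff)
  qed
qed

lemma (in wf_digraph) tension_potential_diff:
  assumes "\<And>e. e \<in> arcs G \<Longrightarrow> \<tau> e = p (head G e) - p (tail G e)"
  shows "tension G \<tau>"
  unfolding tension_def
proof (intro allI impI)
  fix C assume "circuit G C"
  then obtain u where u: "pre_digraph.awalk (traversal_digraph G) u C u" "distinct C"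
    by (auto simp: circuit_def pre_digraph.cycle_def distinct_map)
  have "walk_sum \<tau> C = 0"
    using walk_sum_potential_diff[of \<tau> p u C u] assms u by simp
  with walk_sum_circuit[OF u(2), of \<tau>]
  show "(\<Sum>e\<in>circuit_pos C. \<tau> e) = (\<Sum>e\<in>circuit_neg C. \<tau> e)" by simp
qed

text \<open>By induction on the length: a nonempty closed walk that is not a circuit revisits a
  vertex or repeats an edge. Repeated edges need a case of their own, since going back and forth
  along one edge is a \<open>cycle\<close> but not a \<open>circuit\<close>.\<close>

lemma (in wf_digraph) tension_closed_walk:
  assumes "tension G \<tau>" "pre_digraph.awalk (traversal_digraph G) u p u"
  shows "walk_sum \<tau> p = 0"
proof -
  interpret T: wf_digraph "traversal_digraph G"
    using wf_digraph by (rule wf_traversal_digraph)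
  show ?thesis
    using assms(2)
  proof (induction "length p" arbitrary: p u rule: less_induct)
    case less
    consider "p = []" | "circuit G p" | "p \<noteq> []" "\<not> distinct (tl (T.awalk_verts u p))"
      | "\<not> distinct (map fst p)"
      using less.prems by (auto simp: circuit_def T.cycle_def)
    then show ?case
    proof cases
      case 1
      then show ?thesis by simp
    next
      case 2
      then have "distinct p" by (simp add: circuit_def distinct_map)
      with 2 assms(1) show ?thesis by (simp add: tension_def walk_sum_circuit)
    next
      case 3
      then obtain e b p' where p: "p = (e, b) # p'" by (cases p) auto
      let ?h = "head (traversal_digraph G) (e, b)"
      have "T.awalk ?h p' u" "\<not> distinct (T.awalk_verts ?h p')"
        using 3 less.prems by (auto simp: p T.awalk_Cons_iff)
      from T.awalk_not_distinct_decomp[OF this] obtain q r s w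
        where p': "p' = q @ r @ s" "0 < length r"
          and w: "T.awalk ?h q w" "T.awalk w r w" "T.awalk w s u"
        by blast
      \<comment> \<open>The first arc stays with the remainder, so both pieces are shorter than
        \<open>p\<close> even if \<open>r\<close> is all of \<open>p'\<close>.\<close>
      have "walk_sum \<tau> r = 0"
        using less.hyps[of r w] w p' by (simp add: p)
      moreover have "T.awalk ?h (q @ s) u"
        using w(1,3) by (rule T.awalk_appendI)
      then have "walk_sum \<tau> ((e, b) # q @ s) = 0"
        using less.hyps[of "(e, b) # q @ s" u] p' less.prems by (simp add: p T.awalk_Cons_iff)
      ultimately show ?thesis by (simp add: p p' algebra_simps)
    next
      case 4
      then obtain xs y ys zs where "map fst p = xs @ [y] @ ys @ [y] @ zs"
        using not_distinct_decomp by blast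
      then obtain p1 b p2 b' p3 where p: "p = p1 @ (y, b) # p2 @ (y, b') # p3"
        by (auto simp: map_eq_append_conv map_eq_Cons_conv append_eq_map_conv Cons_eq_map_conv)
      let ?s = "tail (traversal_digraph G) (y, b)" and ?t = "head (traversal_digraph G) (y, b)"
      let ?s' = "tail (traversal_digraph G) (y, b')" and ?t' = "head (traversal_digraph G) (y, b')"
      obtain e: "y \<in> arcs G" and w: "T.awalk u p1 ?s" "T.awalk ?t p2 ?s'" "T.awalk ?t' p3 u"
        using less.prems unfolding p by (auto simp: T.awalk_Cons_iff)
      show ?thesis
      proof (cases "b = b'")
        case True
        then have "T.awalk ?s ((y, b) # p2) ?s" "T.awalk u (p1 @ (y, b) # p3) u"
          using w e by (auto simp: T.awalk_Cons_iff intro: T.awalk_appendI)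
        then have "walk_sum \<tau> ((y, b) # p2) = 0" "walk_sum \<tau> (p1 @ (y, b) # p3) = 0"
          using less.hyps[of "(y, b) # p2"] less.hyps[of "p1 @ (y, b) # p3"] by (auto simp: p)
        moreover have "walk_sum \<tau> p = walk_sum \<tau> ((y, b) # p2) + walk_sum \<tau> (p1 @ (y, b) # p3)"
          using True by (simp add: p add_ac)
        ultimately show ?thesis by simp
      next
        \<comment> \<open>Opposite traversals of \<open>y\<close> cancel, and leaving out both
          splits the walk into the closed walks \<open>p2\<close> and
          \<open>p1 @ p3\<close>.\<close>
        case False
        then have b': "b' = (\<not> b)" by simp
        then have "T.awalk ?t p2 ?t" "T.awalk u (p1 @ p3) u"
          using w by (auto intro: T.awalk_appendI split: if_splits)
        then have "walk_sum \<tau> p2 = 0" "walk_sum \<tau> (p1 @ p3) = 0"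
          using less.hyps[of p2] less.hyps[of "p1 @ p3"] by (auto simp: p)
        then show ?thesis by (simp add: p b' algebra_simps)
      qed
    qed
  qed
qed

text \<open>This hides the walks: concatenation adds the values, reversal negates them, and for a
  tension \<open>m\<close> is the potential difference from \<open>u\<close> to
  \<open>v\<close>.\<close>

definition joined ::
    "('v, 'e) pre_digraph \<Rightarrow> ('e \<Rightarrow> 'm::ab_group_add) \<Rightarrow> 'v \<Rightarrow> 'm \<Rightarrow> 'v \<Rightarrow> bool" where
  "joined G \<tau> u m v \<longleftrightarrow>
     (\<exists>p. pre_digraph.awalk (traversal_digraph G) u p v \<and> walk_sum \<tau> p = m)"

context wf_digraph
begin

interpretation T: wf_digraph "traversal_digraph G"
  using wf_digraph by (rule wf_traversal_digraph)

lemma joined_refl: "u \<in> verts G \<Longrightarrow> joined G \<tau> u 0 u"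
  unfolding joined_def by (intro exI[of _ "[]"]) (simp add: T.awalk_Nil_iff)

lemma joined_arc: "e \<in> arcs G \<Longrightarrow> joined G \<tau> (tail G e) (\<tau> e) (head G e)"
  unfolding joined_def by (intro exI[of _ "[(e, True)]"]) (simp add: T.awalk_simps)

lemma joined_trans:
  assumes "joined G \<tau> u m v" "joined G \<tau> v n w"
  shows "joined G \<tau> u (m + n) w"
  using assms unfolding joined_def by (metis T.awalk_appendI walk_sum_simps(3))

lemma joined_sym:
  assumes "joined G \<tau> u m v"
  shows "joined G \<tau> v (- m) u"
proof -
  have "joined G \<tau> v (- walk_sum \<tau> p) u" if "T.awalk u p v" for p
    using that
  proof (induction p arbitrary: u)
    case Nil
    then show ?case by (auto simp: T.awalk_Nil_iff joined_refl)
  next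
    case (Cons a p)
    obtain e b where a: "a = (e, b)" by fastforce
    let ?h = "head (traversal_digraph G) a"
    from Cons have *: "e \<in> arcs G" "u = tail (traversal_digraph G) a" "joined G \<tau> v (- walk_sum \<tau> p) ?h"
      by (auto simp: T.awalk_Cons_iff a)
    have "joined G \<tau> ?h (- (if b then \<tau> e else - \<tau> e)) u"
      unfolding joined_def using * by (intro exI[of _ "[(e, \<not> b)]"]) (simp add: a T.awalk_simps)
    from joined_trans[OF *(3) this] show ?case by (simp add: a algebra_simps)
  qed
  with assms show ?thesis by (auto simp: joined_def)
qed

lemma joined_unique:
  assumes "tension G \<tau>" "joined G \<tau> u m v" "joined G \<tau> u n v"
  shows "m = n"
  using joined_trans[OF assms(2) joined_sym[OF assms(3)]] tension_closed_walk[OF assms(1)]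
  by (auto simp: joined_def)

end

section \<open>Shift graphs times the transitive triangle\<close>

text \<open>
  A vertex is a pair of a layer below 3 and a \<open>k\<close>-subset of \<open>{..<N}\<close>; an arc is a pair of a
  type below 3 and a \<open>(k + 1)\<close>-subset. The types 0, 1, 2 stand for the arcs from layer 0 to 1,
  1 to 2 and 0 to 2.
\<close>

definition enc :: "nat \<Rightarrow> nat set \<Rightarrow> nat" where
  "enc i A = prod_encode (i, set_encode A)"

definition layer :: "nat \<Rightarrow> nat" where
  "layer v = fst (prod_decode v)"

definition vset :: "nat \<Rightarrow> nat set" where
  "vset v = set_decode (snd (prod_decode v))"

lemma layer_enc [simp]: "layer (enc i A) = i"
  by (simp add: layer_def enc_def)

lemma vset_enc [simp]: "finite A \<Longrightarrow> vset (enc i A) = A"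
  by (simp add: vset_def enc_def)

lemma finite_vset [simp]: "finite (vset v)"
  by (simp add: vset_def)

text \<open>Vertices and arcs are coded as numbers so that all graphs of the antichain share one
  type.\<close>

definition shift_graph :: "nat \<Rightarrow> nat \<Rightarrow> (nat, nat) pre_digraph" where
  "shift_graph k N =
     \<lparr> verts = (\<lambda>(i, A). enc i A) ` ({..<3} \<times> nsets {..<N} k),
       arcs = (\<lambda>(i, A). enc i A) ` ({..<3} \<times> nsets {..<N} (Suc k)),
       tail = (\<lambda>e. enc (if layer e = 1 then 1 else 0) (vset e - {Max (vset e)})),
       head = (\<lambda>e. enc (if layer e = 0 then 1 else 2) (vset e - {Min (vset e)})) \<rparr>"

lemma shift_graph_tail:
  "tail (shift_graph k N) = (\<lambda>e. enc (if layer e = 1 then 1 else 0) (vset e - {Max (vset e)}))"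
  and shift_graph_head:
  "head (shift_graph k N) = (\<lambda>e. enc (if layer e = 0 then 1 else 2) (vset e - {Min (vset e)}))"
  by (simp_all add: shift_graph_def)

lemma shift_graph_vertI: "i < 3 \<Longrightarrow> A \<in> nsets {..<N} k \<Longrightarrow> enc i A \<in> verts (shift_graph k N)"
  and shift_graph_arcI: "i < 3 \<Longrightarrow> A \<in> nsets {..<N} (Suc k) \<Longrightarrow> enc i A \<in> arcs (shift_graph k N)"
  by (auto simp: shift_graph_def)

lemma shift_graph_vertD: "v \<in> verts (shift_graph k N) \<Longrightarrow> layer v < 3 \<and> card (vset v) = k"
  and shift_graph_arcD: "e \<in> arcs (shift_graph k N) \<Longrightarrow> layer e < 3 \<and> vset e \<in> nsets {..<N} (Suc k)"
  by (auto simp: shift_graph_def nsets_def)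

lemma finite_loopless_shift_graph: "finite_loopless_digraph (shift_graph k N)"
proof -
  have "wf_digraph (shift_graph k N)"
  proof
    fix e assume "e \<in> arcs (shift_graph k N)"
    then have A: "vset e \<subseteq> {..<N}" "card (vset e) = Suc k"
      using shift_graph_arcD[of e k N] by (auto simp: nsets_def)
    then have "vset e \<noteq> {}" by auto
    then have "Max (vset e) \<in> vset e" "Min (vset e) \<in> vset e" by auto
    with A have "vset e - {Max (vset e)} \<in> nsets {..<N} k" "vset e - {Min (vset e)} \<in> nsets {..<N} k"
      by (auto simp: nsets_def)
    then show "tail (shift_graph k N) e \<in> verts (shift_graph k N)"
      "head (shift_graph k N) e \<in> verts (shift_graph k N)"
      by (auto simp: shift_graph_tail shift_graph_head intro!: shift_graph_vertI)
  qed
  moreover have "finite (verts (shift_graph k N))" "finite (arcs (shift_graph k N))"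
    by (auto simp: shift_graph_def intro!: finite_imp_finite_nsets)
  moreover have "tail (shift_graph k N) e \<noteq> head (shift_graph k N) e" for e
  proof
    assume "tail (shift_graph k N) e = head (shift_graph k N) e"
    then have "layer (tail (shift_graph k N) e) = layer (head (shift_graph k N) e)" by simp
    then show False by (simp add: shift_graph_tail shift_graph_head split: if_splits)
  qed
  ultimately show ?thesis
    by (simp add: finite_loopless_digraph_def fin_digraph_def fin_digraph_axioms_def
        loopfree_digraph_def loopfree_digraph_axioms_def)
qed

lemma chromatic_number_shift_graph: "chromatic_number (shift_graph k N) \<le> 3"
  unfolding chromatic_number_def
proof (rule Least_le, intro exI[of _ layer])
  show "proper_coloring (shift_graph k N) 3 layer"
    by (auto simp: proper_coloring_def shift_graph_tail shift_graph_head dest: shift_graph_vertD)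
qed

lemma wf_shift_graph: "wf_digraph (shift_graph k N)"
  using finite_loopless_shift_graph[of k N]
  by (simp add: finite_loopless_digraph_def fin_digraph_def)

subsection \<open>Few arcs of a shift graph carry a constant tension\<close>

text \<open>The number \<open>d\<close> counts the steps along arcs that \<open>t\<close> is sure to
  survive: a step removes only an extreme element.\<close>

definition deep :: "nat \<Rightarrow> nat \<Rightarrow> nat \<Rightarrow> bool" where
  "deep d t v \<longleftrightarrow> t \<in> vset v \<and> d \<le> card {y \<in> vset v. y < t} \<and> d \<le> card {y \<in> vset v. t < y}"

lemma deep_mono: "c \<le> d \<Longrightarrow> deep d t v \<Longrightarrow> deep c t v"
  unfolding deep_def by (blast intro: order_trans)

text \<open>The element at index \<open>d\<close> in increasing order serves: exactly
  \<open>d\<close> elements precede it and at least \<open>d\<close> follow.\<close>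

lemma deep_exists:
  assumes "2 * d < card (vset v)"
  shows "\<exists>t. deep d t v"
proof -
  obtain xs where xs: "sorted_wrt (<) xs" "set xs = vset v" "length xs = card (vset v)"
    using finite_set_strict_sorted[OF finite_vset] by metis
  then have *: "xs ! i < xs ! j" if "i < j" "j < length xs" for i j
    using that xs(1) by (simp add: sorted_wrt_nth_less)
  have mem: "xs ! i \<in> vset v" if "i < length xs" for i
    using nth_mem[OF that] xs(2) by simp
  have inj: "inj_on ((!) xs) {..<length xs}"
    using xs(1) by (intro inj_on_nth) (auto simp: strict_sorted_iff)
  have "card ((!) xs ` {..<d}) \<le> card {y \<in> vset v. y < xs ! d}"
    using assms * xs(3) mem by (intro card_mono) auto
  moreover have "card ((!) xs ` {d<..<length xs}) \<le> card {y \<in> vset v. xs ! d < y}"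
    using assms * xs(3) mem by (intro card_mono) auto
  moreover have "card ((!) xs ` {..<d}) = d"
    using assms xs by (subst card_image) (auto intro: inj_on_subset[OF inj])
  moreover have "card ((!) xs ` {d<..<length xs}) = length xs - Suc d"
    by (subst card_image) (auto intro: inj_on_subset[OF inj])
  ultimately have "deep d (xs ! d) v"
    using assms xs(3) mem by (auto simp: deep_def)
  then show ?thesis ..
qed

lemma deep_diff:
  assumes "vset v - {a} \<subseteq> vset w" "deep (Suc d) t v" "a \<noteq> t"
  shows "deep d t w"
proof -
  have "card {y \<in> vset v. P y} \<le> Suc (card {y \<in> vset w. P y})" for P
  proof -
    have "card {y \<in> vset v. P y} \<le> card (insert a {y \<in> vset w. P y})"
      using assms(1) by (intro card_mono) auto
    also have "\<dots> \<le> Suc (card {y \<in> vset w. P y})" by (simp add: card_insert_le_m1 card_insert_if)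
    finally show ?thesis .
  qed
  from this[of "\<lambda>y. y < t"] this[of "\<lambda>y. t < y"] show ?thesis
    using assms by (auto simp: deep_def)
qed

text \<open>Used for a step between the two ends of an arc with set \<open>A\<close>, in either
  direction. The only element that can get lost is \<open>b\<close>, and it differs from
  \<open>t\<close> because \<open>v\<close> has elements on both sides of \<open>t\<close>.\<close>

lemma deep_extremal:
  assumes "deep (Suc d) t v" "v = enc i (A - {a})" "finite A" "w = enc j (A - {b})"
    and "b = Min A \<or> b = Max A"
  shows "deep d t w"
proof -
  have "{y \<in> vset v. y < t} \<noteq> {}" "{y \<in> vset v. t < y} \<noteq> {}"
    using assms(1) by (force simp: deep_def)+
  then obtain x y where "x \<in> A" "x < t" "y \<in> A" "t < y"
    using assms by auto
  then have "b \<noteq> t"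
    using assms(3,5) by (metis Max_ge Min_le leD)
  have "vset v - {b} \<subseteq> vset w"
    using assms(2-4) by auto
  then show ?thesis using assms(1) \<open>b \<noteq> t\<close> by (rule deep_diff)
qed

text \<open>In each component formed by the arcs of \<open>S\<close> some \<open>t\<close> lies
  strictly inside every vertex set. The tension comes from a potential that counts elements above
  \<open>t\<close> in units of \<open>x\<close>; its values outside \<open>S\<close> do not
  matter.\<close>

lemma shift_graph_constant_tension:
  fixes x :: "'m::ab_group_add"
  assumes S: "S \<subseteq> arcs (shift_graph k N)" "4 * card S + 3 \<le> k"
  shows "\<exists>\<tau>. tension (shift_graph k N) \<tau> \<and> (\<forall>e\<in>S. \<tau> e = x)"
proof -
  let ?G = "shift_graph k N"
  interpret wf_digraph ?G by (rule wf_shift_graph)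
  \<comment> \<open>Both directions of each arc are included, so the classes of
    \<open>R\<^sup>*\<close> are the components formed by \<open>S\<close>.\<close>
  define R where "R = (\<lambda>e. (tail ?G e, head ?G e)) ` S \<union> (\<lambda>e. (head ?G e, tail ?G e)) ` S"
  have "finite (arcs ?G)"
    using finite_loopless_shift_graph by (simp add: finite_loopless_digraph_def fin_digraph.finite_arcs)
  with S(1) have fS: "finite S" by (rule finite_subset)
  then have finR: "finite R" by (simp add: R_def)
  have cardR: "card R \<le> 2 * card S"
    unfolding R_def using card_Un_le[of "(\<lambda>e. (tail ?G e, head ?G e)) ` S" "(\<lambda>e. (head ?G e, tail ?G e)) ` S"]
      card_image_le[OF fS, of "\<lambda>e. (tail ?G e, head ?G e)"] card_image_le[OF fS, of "\<lambda>e. (head ?G e, tail ?G e)"]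
    by linarith
  have step: "deep d t w" if vw: "(v, w) \<in> R" "deep (Suc d) t v" for d t v w
  proof -
    obtain e where "v = tail ?G e \<and> w = head ?G e \<or> v = head ?G e \<and> w = tail ?G e"
      using vw(1) unfolding R_def by blast
    then show ?thesis
      unfolding shift_graph_tail shift_graph_head
      using deep_extremal[OF vw(2) _ finite_vset] by blast
  qed
  have steps: "deep d t w" if "(v, w) \<in> R ^^ n" "deep (d + n) t v" for d t v w n
    using that
  proof (induction n arbitrary: d w)
    case 0
    then show ?case by simp
  next
    case (Suc n)
    then obtain u where "(v, u) \<in> R ^^ n" "(u, w) \<in> R" by auto
    with Suc.IH[of u "Suc d"] Suc.prems show ?case by (auto intro: step)
  qed
  have "sym R" by (auto simp: sym_def R_def)
  then have "equiv UNIV (R\<^sup>*)"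
    by (simp add: equiv_def refl_rtrancl sym_rtrancl trans_rtrancl)
  then have classes: "R\<^sup>* `` {v} = R\<^sup>* `` {w}" if "(v, w) \<in> R\<^sup>*" for v w
    using that by (simp add: equiv_class_eq)
  define r where "r v = (SOME u. u \<in> R\<^sup>* `` {v})" for v
  have r: "(v, r v) \<in> R\<^sup>*" for v
    unfolding r_def using someI[of "\<lambda>u. u \<in> R\<^sup>* `` {v}" v] by auto
  \<comment> \<open>Defined through the representative \<open>r v\<close>, \<open>t\<close> is
    constant on classes. At most \<open>card R \<le> 2 * card S\<close> steps lead from
    \<open>r v\<close> to \<open>v\<close>, so depth 1 is left there. The depth chosen at
    \<open>r v\<close> requires \<open>4 * card S + 2 < k\<close>.\<close>
  define t where "t v = (SOME s. deep (Suc (2 * card S)) s (r v))" for v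
  have t: "deep 1 (t v) v" if "v \<in> verts ?G" for v
  proof -
    have "R\<^sup>* `` verts ?G = verts ?G"
      by (rule Image_closed_trancl) (use S in \<open>auto simp: R_def\<close>)
    with r[of v] that have "r v \<in> verts ?G" by auto
    then have "2 * Suc (2 * card S) < card (vset (r v))"
      using S(2) shift_graph_vertD[of "r v" k N] by simp
    then have *: "deep (Suc (2 * card S)) (t v) (r v)"
      unfolding t_def by (rule someI_ex[OF deep_exists])
    have "(r v, v) \<in> R\<^sup>*"
      by (rule symD[OF sym_rtrancl[OF \<open>sym R\<close>] r])
    then obtain n where n: "n \<le> card R" "(r v, v) \<in> R ^^ n"
      unfolding rtrancl_finite_eq_relpow[OF finR] by blast
    then have "deep (1 + n) (t v) (r v)"
      using cardR * by (intro deep_mono[of "1 + n" "Suc (2 * card S)"]) auto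
    with n(2) show ?thesis by (rule steps)
  qed
  define p where "p v = (\<Sum>y\<in>{y \<in> vset v. t v < y}. x)" for v
  have "p (head ?G e) - p (tail ?G e) = x" if "e \<in> S" for e
  proof -
    let ?u = "tail ?G e" and ?v = "head ?G e" and ?A = "vset e"
    have e: "e \<in> arcs ?G" using that S by auto
    have "(?u, ?v) \<in> R" using that by (simp add: R_def)
    then have "R\<^sup>* `` {?u} = R\<^sup>* `` {?v}"
      by (intro classes) auto
    then have tt: "t ?u = t ?v" by (simp add: t_def r_def)
    have "deep 1 (t ?u) ?u" "deep 1 (t ?u) ?v"
      using t[of ?u] t[of ?v] e by (simp_all add: tt)
    then have "{y \<in> vset ?u. y < t ?u} \<noteq> {}" "{y \<in> vset ?v. t ?u < y} \<noteq> {}"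
      by (force simp: deep_def)+
    then obtain a b where "a \<in> ?A" "a < t ?u" "b \<in> ?A" "t ?u < b"
      by (auto simp: shift_graph_tail shift_graph_head)
    then have minmax: "Min ?A < t ?u" "t ?u < Max ?A" "Max ?A \<in> ?A"
      by (meson Min_le finite_vset le_less_trans, meson Max_ge finite_vset less_le_trans,
        metis Max_in empty_iff finite_vset)
    \<comment> \<open>From tail to head the set loses its minimum, which lies below
      \<open>t\<close>, and gains a maximum above \<open>t\<close>.\<close>
    have "{y \<in> vset ?v. t ?u < y} = insert (Max ?A) {y \<in> vset ?u. t ?u < y}"
      using minmax by (auto simp: shift_graph_tail shift_graph_head)
    then have "p ?v = x + p ?u"
      unfolding p_def tt[symmetric] by (simp, subst sum.insert) (auto simp: shift_graph_tail)
    then show ?thesis by simp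
  qed
  moreover have "tension ?G (\<lambda>e. p (head ?G e) - p (tail ?G e))"
    by (rule tension_potential_diff) auto
  ultimately show ?thesis by auto
qed

subsection \<open>Closed walks winding around the triangle\<close>

text \<open>Turns \<open>Suc k\<close> consecutive terms of an increasing sequence into an arc set;
  its two ends are the \<open>k\<close>-windows starting at \<open>j\<close> and
  \<open>Suc j\<close>.\<close>

lemma window_arc:
  fixes z :: "nat \<Rightarrow> nat"
  assumes "strict_mono_on {..<n} z" "z ` {..<n} \<subseteq> X" "j + k < n"
  defines "A \<equiv> z ` {j..<Suc (j + k)}"
  shows "A \<in> nsets X (Suc k)" "A - {Max A} = z ` {j..<j + k}"
    "A - {Min A} = z ` {Suc j..<Suc (j + k)}"
proof -
  have inj: "inj_on z {j..<Suc (j + k)}"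
    using assms(3) by (intro inj_on_subset[OF strict_mono_on_imp_inj_on[OF assms(1)]]) auto
  then have "card A = Suc k"
    unfolding A_def by (subst card_image) auto
  with assms(2,3) show "A \<in> nsets X (Suc k)"
    by (auto simp: A_def nsets_def)
  have mono: "z a \<le> z b" if "a \<le> b" "b < n" for a b
    using that strict_mono_onD[OF assms(1), of a b] by (cases "a = b") auto
  have "Max A = z (j + k)" "Min A = z j"
    unfolding A_def using assms(3) by (auto intro!: Max_eqI Min_eqI mono)
  moreover have "{j..<j + k} = {j..<Suc (j + k)} - {j + k}"
    "{Suc j..<Suc (j + k)} = {j..<Suc (j + k)} - {j}"
    by auto
  ultimately show "A - {Max A} = z ` {j..<j + k}" "A - {Min A} = z ` {Suc j..<Suc (j + k)}"
    using inj by (auto simp: A_def inj_on_image_set_diff[OF inj])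
qed

text \<open>
  The walk goes from layer 0 up to layers 1 and 2 and directly back to 0: the window moves by
  one position and the tension sums to \<open>x + x - x\<close>.
\<close>

lemma joined_window_step:
  fixes z :: "nat \<Rightarrow> nat" and x :: "'m::ab_group_add"
  assumes val: "\<forall>i<3. \<forall>A \<in> nsets X (Suc k). \<tau> (enc i A) = x"
    and X: "X \<subseteq> {..<N}"
    and z: "strict_mono_on {..<n} z" "z ` {..<n} \<subseteq> X" "Suc (j + k) < n"
  shows "joined (shift_graph k N) \<tau> (enc 0 (z ` {j..<j + k})) x
           (enc 0 (z ` {Suc j..<Suc (j + k)}))"
proof -
  let ?G = "shift_graph k N"
  interpret wf_digraph ?G by (rule wf_shift_graph)
  have arc: "joined ?G \<tau> (enc (if i = 1 then 1 else 0) (z ` {l..<l + k})) x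
      (enc (if i = 0 then 1 else 2) (z ` {Suc l..<Suc (l + k)}))" if "i < 3" "l + k < n" for i l :: nat
  proof -
    let ?A = "z ` {l..<Suc (l + k)}"
    note A = window_arc[OF z(1,2) that(2)]
    have "?A \<in> nsets {..<N} (Suc k)"
      using A(1) nsets_mono[OF X] by blast
    then have "enc i ?A \<in> arcs ?G" using that(1) by (rule shift_graph_arcI[rotated])
    from joined_arc[OF this, of \<tau>] show ?thesis
      using A that(1) by (simp add: shift_graph_tail shift_graph_head val)
  qed
  have "joined ?G \<tau> (enc 0 (z ` {j..<j + k})) x (enc 1 (z ` {Suc j..<Suc (j + k)}))"
    using arc[of 0 j] z(3) by simp
  moreover have "joined ?G \<tau> (enc 1 (z ` {Suc j..<Suc (j + k)})) x
      (enc 2 (z ` {Suc (Suc j)..<Suc (Suc (j + k))}))"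
    using arc[of 1 "Suc j"] z(3) by simp
  moreover have "joined ?G \<tau> (enc 2 (z ` {Suc (Suc j)..<Suc (Suc (j + k))})) (- x)
      (enc 0 (z ` {Suc j..<Suc (j + k)}))"
    using joined_sym[OF arc[of 2 "Suc j"]] z(3) by simp
  ultimately have "joined ?G \<tau> (enc 0 (z ` {j..<j + k})) (x + (x + - x))
      (enc 0 (z ` {Suc j..<Suc (j + k)}))"
    by (blast intro: joined_trans)
  then show ?thesis by simp
qed

lemma joined_window_steps:
  fixes z :: "nat \<Rightarrow> nat" and x :: "'m::ab_group_add"
  assumes val: "\<forall>i<3. \<forall>A \<in> nsets X (Suc k). \<tau> (enc i A) = x"
    and X: "X \<subseteq> {..<N}"
    and z: "strict_mono_on {..<n} z" "z ` {..<n} \<subseteq> X" "j + k < n"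
  shows "joined (shift_graph k N) \<tau> (enc 0 (z ` {..<k})) (\<Sum>i<j. x) (enc 0 (z ` {j..<j + k}))"
  using z(3)
proof (induction j)
  case 0
  interpret wf_digraph "shift_graph k N" by (rule wf_shift_graph)
  have "inj_on z {..<k}"
    using 0 by (intro inj_on_subset[OF strict_mono_on_imp_inj_on[OF z(1)]]) auto
  then have "z ` {..<k} \<in> nsets {..<N} k"
    using 0 image_mono[of "{..<k}" "{..<n}" z] order_trans[OF z(2) X]
    by (auto simp: nsets_def card_image)
  then show ?case
    by (auto simp: lessThan_atLeast0 intro!: joined_refl shift_graph_vertI)
next
  case (Suc j)
  interpret wf_digraph "shift_graph k N" by (rule wf_shift_graph)
  from Suc joined_trans[OF Suc.IH joined_window_step[OF val X z(1,2)]]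
  show ?case by (simp add: add.commute)
qed

text \<open>
  The bottom and the top \<open>k\<close>-window of a \<open>(2 k + 1)\<close>-set are joined by \<open>k + 1\<close> window steps, and
  by \<open>k\<close> steps if the middle element is skipped. The last step needs one more element above.
\<close>

lemma tension_constant_on_large_set:
  fixes x :: "'m::ab_group_add"
  assumes ten: "tension (shift_graph k N) \<tau>"
    and val: "\<forall>i<3. \<forall>A \<in> nsets X (Suc k). \<tau> (enc i A) = x"
    and X: "X \<subseteq> {..<N}" "2 * k + 2 \<le> card X"
  shows "x = 0"
proof -
  interpret wf_digraph "shift_graph k N" by (rule wf_shift_graph)
  have "finite X" using X(1) finite_subset by blast
  then obtain xs where xs: "sorted_wrt (<) xs" "set xs = X" "length xs = card X"
    using finite_set_strict_sorted by metis
  define z where "z = (!) xs"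
  have z: "strict_mono_on {..<2 * k + 2} z" "z ` {..<2 * k + 2} \<subseteq> X"
    using xs X(2) nth_mem[of _ xs] by (auto simp: strict_mono_on_def z_def sorted_wrt_nth_less)
  define y where "y i = z (if i < k then i else Suc i)" for i
  have y: "strict_mono_on {..<2 * k + 1} y" "y ` {..<2 * k + 1} \<subseteq> X"
    using z(2) strict_mono_onD[OF z(1)] by (auto simp: strict_mono_on_def y_def)
  have img: "y ` {..<k} = z ` {..<k}" "y ` {k..<k + k} = z ` {Suc k..<Suc k + k}"
  proof -
    show "y ` {..<k} = z ` {..<k}" by (auto simp: y_def)
    have "y ` {k..<k + k} = z ` Suc ` {k..<k + k}"
      unfolding image_image by (rule image_cong) (auto simp: y_def)
    then show "y ` {k..<k + k} = z ` {Suc k..<Suc k + k}" by simp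
  qed
  have "joined (shift_graph k N) \<tau> (enc 0 (z ` {..<k})) (\<Sum>i<Suc k. x)
      (enc 0 (z ` {Suc k..<Suc k + k}))"
    by (rule joined_window_steps[OF val X(1) z]) auto
  moreover have "joined (shift_graph k N) \<tau> (enc 0 (z ` {..<k})) (\<Sum>i<k. x)
      (enc 0 (z ` {Suc k..<Suc k + k}))"
    using joined_window_steps[OF val X(1) y, of k] by (simp add: img)
  \<comment> \<open>Since the two lengths differ by exactly one, cancellation gives
    \<open>x = 0\<close> even if the group has torsion.\<close>
  ultimately have "(\<Sum>i<Suc k. x) = (\<Sum>i<k. x)"
    by (rule joined_unique[OF ten])
  then show ?thesis by simp
qed

section \<open>The antichain\<close>

text \<open>A tension with value \<open>x\<close> on the few arcs in \<open>S\<close> would pull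
  back to one that is constantly \<open>x\<close> on all arcs within the large set \<open>X\<close>,
  forcing \<open>x = 0\<close>.\<close>

lemma no_tension_continuous_few_values:
  fixes x :: "'m::ab_group_add"
  assumes "x \<noteq> 0" and X: "X \<subseteq> {..<N}" "2 * k + 2 \<le> card X"
    and S: "\<And>i A. i < 3 \<Longrightarrow> A \<in> nsets X (Suc k) \<Longrightarrow> f (enc i A) \<in> S"
      "finite S" "4 * card S + 3 \<le> k'"
  shows "\<not> tension_continuous TYPE('m) (shift_graph k N) (shift_graph k' N') f"
proof
  assume f: "tension_continuous TYPE('m) (shift_graph k N) (shift_graph k' N') f"
  let ?S = "S \<inter> arcs (shift_graph k' N')"
  have "card ?S \<le> card S" using S(2) by (intro card_mono) auto
  then have "4 * card ?S + 3 \<le> k'" using S(3) by linarith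
  from shift_graph_constant_tension[OF Int_lower2 this, of x] obtain \<tau>
    where \<tau>: "tension (shift_graph k' N') \<tau>" "\<forall>e\<in>?S. \<tau> e = x"
    by blast
  have "tension (shift_graph k N) (\<tau> \<circ> f)"
    using f \<tau>(1) by (simp add: tension_continuous_def)
  moreover have "\<forall>i<3. \<forall>A \<in> nsets X (Suc k). (\<tau> \<circ> f) (enc i A) = x"
  proof (intro allI impI ballI)
    fix i :: nat and A
    assume that: "i < 3" "A \<in> nsets X (Suc k)"
    have "enc i A \<in> arcs (shift_graph k N)"
      using that nsets_mono[OF X(1)] by (auto intro: shift_graph_arcI)
    then have "f (enc i A) \<in> ?S"
      using f S(1)[OF that] by (auto simp: tension_continuous_def)
    with \<tau>(2) show "(\<tau> \<circ> f) (enc i A) = x" by simp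
  qed
  ultimately have "x = 0" by (rule tension_constant_on_large_set[OF _ _ X])
  with \<open>x \<noteq> 0\<close> show False ..
qed

text \<open>Ramsey's theorem with equal targets \<open>m\<close>, carried over to an arbitrary
  finite colour set by numbering the colours.\<close>

lemma ramsey_finite_colors:
  assumes "finite C"
  shows "\<exists>N::nat. \<forall>f \<in> nsets {..<N} r \<rightarrow> C. \<exists>X c. X \<subseteq> {..<N} \<and> card X = m \<and> f ` nsets X r \<subseteq> {c}"
proof -
  let ?qs = "replicate (card C) m"
  obtain h where h: "bij_betw h C {..<card C}"
    using ex_bij_betw_finite_nat[OF assms] by (auto simp: lessThan_atLeast0)
  obtain N :: nat where N: "partn_lst {..<N} ?qs r"
    using ramsey_full by blast
  have "\<exists>X c. X \<subseteq> {..<N} \<and> card X = m \<and> f ` nsets X r \<subseteq> {c}" if f: "f \<in> nsets {..<N} r \<rightarrow> C" for f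
  proof -
    have "h \<circ> f \<in> nsets {..<N} r \<rightarrow> {..<length ?qs}"
      using f bij_betwE[OF h] by auto
    from partn_lstE[OF N this] obtain i X
      where X: "i < card C" "X \<in> nsets {..<N} m" "(h \<circ> f) ` nsets X r \<subseteq> {i}"
      by (metis length_replicate nth_replicate)
    then have XN: "X \<subseteq> {..<N}" "card X = m" by (auto simp: nsets_def)
    have "f A = inv_into C h i" if "A \<in> nsets X r" for A
    proof -
      have "f A \<in> C" using f that nsets_mono[OF XN(1)] by auto
      moreover have "h (f A) = i" using X(3) that by auto
      ultimately show ?thesis using h by (auto simp: bij_betw_def)
    qed
    with XN show ?thesis by blast
  qed
  then show ?thesis by blast
qed

text \<open>First \<open>k\<close> is taken large against the arcs of the graphs in
  \<open>F\<close>, which rules out maps from them; then \<open>N\<close> is taken from Ramsey's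
  theorem for this \<open>k\<close>, which rules out maps to them. The bound 15 is
  \<open>4 * 3 + 3\<close>, enough for three arc values; \<open>2 * k + 2 \<le> N\<close> makes
  \<open>{..<N}\<close> itself a large set.\<close>

lemma shift_graph_incomparable_extension:
  fixes x :: "'m::ab_group_add"
  assumes "x \<noteq> 0" "finite F" and F: "\<And>k N. (k, N) \<in> F \<Longrightarrow> 15 \<le> k \<and> 2 * k + 2 \<le> N"
  shows "\<exists>k N. 15 \<le> k \<and> 2 * k + 2 \<le> N \<and> (\<forall>(l, L) \<in> F.
           \<not> tension_le TYPE('m) (shift_graph k N) (shift_graph l L) \<and>
           \<not> tension_le TYPE('m) (shift_graph l L) (shift_graph k N))"
proof -
  define D where "D = (\<Union>(l, L)\<in>F. arcs (shift_graph l L))"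
  have fin: "finite (arcs (shift_graph l L))" for l L
    using finite_loopless_shift_graph by (simp add: finite_loopless_digraph_def fin_digraph.finite_arcs)
  then have finD: "finite D" using \<open>finite F\<close> by (auto simp: D_def)
  define k where "k = 4 * card D + 15"
  have "finite (D \<times> D \<times> D)" using finD by simp
  from ramsey_finite_colors[OF this, of "Suc k" "2 * k + 2"]
  obtain N :: nat where N: "\<forall>f \<in> nsets {..<N} (Suc k) \<rightarrow> D \<times> D \<times> D.
      \<exists>X c. X \<subseteq> {..<N} \<and> card X = 2 * k + 2 \<and> f ` nsets X (Suc k) \<subseteq> {c}"
    by blast
  \<comment> \<open>The maximum secures the size bound for later extensions; the colouring below
    still uses only subsets of \<open>{..<N}\<close>.\<close>
  define N' where "N' = max N (2 * k + 2)"
  have "\<not> tension_le TYPE('m) (shift_graph k N') (shift_graph l L)" if "(l, L) \<in> F" for l L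
  proof
    assume "tension_le TYPE('m) (shift_graph k N') (shift_graph l L)"
    then obtain f where f: "tension_continuous TYPE('m) (shift_graph k N') (shift_graph l L) f"
      by (auto simp: tension_le_def)
    \<comment> \<open>One colour records the images of the arcs of all three types, so
      \<open>f\<close> takes at most three values on the arcs within a homogeneous set.\<close>
    define g where "g A = (f (enc 0 A), f (enc 1 A), f (enc 2 A))" for A
    have sub: "{..<N} \<subseteq> {..<N'}" by (auto simp: N'_def)
    have "f (enc i A) \<in> D" if "i < 3" "A \<in> nsets {..<N} (Suc k)" for i A
    proof -
      have "enc i A \<in> arcs (shift_graph k N')"
        using that nsets_mono[OF sub] by (auto intro: shift_graph_arcI)
      then show ?thesis using f \<open>(l, L) \<in> F\<close> by (auto simp: tension_continuous_def D_def)
    qed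
    then have "g \<in> nsets {..<N} (Suc k) \<rightarrow> D \<times> D \<times> D" by (auto simp: g_def)
    from bspec[OF N this] obtain X a b c
      where X: "X \<subseteq> {..<N}" "card X = 2 * k + 2" "g ` nsets X (Suc k) \<subseteq> {(a, b, c)}"
      by (metis prod_cases3)
    have g: "g A = (a, b, c)" if "A \<in> nsets X (Suc k)" for A
      using X(3) that by auto
    have "card {a, b, c} \<le> 3" by (simp add: card_insert_if)
    then have "4 * card {a, b, c} + 3 \<le> l" using F[OF \<open>(l, L) \<in> F\<close>] by linarith
    moreover have "f (enc i A) \<in> {a, b, c}" if "i < 3" "A \<in> nsets X (Suc k)" for i A
    proof -
      have "i = 0 \<or> i = 1 \<or> i = 2" using that(1) by linarith
      then show ?thesis using g[OF that(2)] by (auto simp: g_def)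
    qed
    ultimately have "\<not> tension_continuous TYPE('m) (shift_graph k N') (shift_graph l L) f"
      using X sub by (intro no_tension_continuous_few_values[OF \<open>x \<noteq> 0\<close>, of X N' k f "{a, b, c}"]) auto
    with f show False by contradiction
  qed
  moreover have "\<not> tension_le TYPE('m) (shift_graph l L) (shift_graph k N')" if "(l, L) \<in> F" for l L
  proof
    let ?A = "arcs (shift_graph l L)"
    assume "tension_le TYPE('m) (shift_graph l L) (shift_graph k N')"
    then obtain f where f: "tension_continuous TYPE('m) (shift_graph l L) (shift_graph k N') f"
      by (auto simp: tension_le_def)
    \<comment> \<open>Here no Ramsey argument is needed: the whole earlier graph has at most
      \<open>card D\<close> arcs, and \<open>X\<close> is all of \<open>{..<L}\<close>.\<close>
    have "card ?A \<le> card D"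
      using that finD by (intro card_mono) (auto simp: D_def)
    then have "4 * card (f ` ?A) + 3 \<le> k"
      using card_image_le[OF fin[of l L], of f] by (simp add: k_def)
    moreover have "f (enc i A) \<in> f ` ?A" if "i < 3" "A \<in> nsets {..<L} (Suc l)" for i A
      using that by (intro imageI shift_graph_arcI)
    moreover have "2 * l + 2 \<le> card {..<L}" using F[OF that] by simp
    moreover have "finite (f ` ?A)" using fin by simp
    ultimately have "\<not> tension_continuous TYPE('m) (shift_graph l L) (shift_graph k N') f"
      by (intro no_tension_continuous_few_values[OF \<open>x \<noteq> 0\<close> subset_refl])
    with f show False by contradiction
  qed
  ultimately show ?thesis
    by (intro exI[of _ k] exI[of _ N']) (auto simp: k_def N'_def)
qed

theorem corollary7:
  assumes nontrivial: "\<exists>x :: 'm::ab_group_add. x \<noteq> 0"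
  shows "\<exists>G :: nat \<Rightarrow> (nat, nat) pre_digraph.
           (\<forall>i. finite_loopless_digraph (G i) \<and> chromatic_number (G i) \<le> 3) \<and>
           (\<forall>i j. i \<noteq> j \<longrightarrow> \<not> tension_le TYPE('m) (G i) (G j))"
proof -
  obtain x :: 'm where "x \<noteq> 0" using nontrivial by blast
  define G where "G = (\<lambda>(k, N). shift_graph k N)"
  \<comment> \<open>The size bounds are part of \<open>P\<close> so that every earlier pair meets
    the hypotheses of the extension lemma. Only \<open>s j\<close> with \<open>j < i\<close> enters,
    as the recursive choice of \<open>s\<close> requires.\<close>
  define P where "P s i r \<longleftrightarrow> 15 \<le> fst r \<and> 2 * fst r + 2 \<le> snd r \<and>
      (\<forall>j<i. \<not> tension_le TYPE('m) (G r) (G (s j)) \<and> \<not> tension_le TYPE('m) (G (s j)) (G r))"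
    for s :: "nat \<Rightarrow> nat \<times> nat" and i :: nat and r
  have "\<exists>s. \<forall>i. P s i (s i)"
  proof (rule dependent_wf_choice[OF wf_less])
    fix s i
    assume *: "\<And>j. (j, i) \<in> {(x, y). x < y} \<Longrightarrow> P s j (s j)"
    have "15 \<le> k \<and> 2 * k + 2 \<le> N" if kN: "(k, N) \<in> s ` {..<i}" for k N
    proof -
      obtain j where "j < i" "s j = (k, N)" using kN by (metis imageE lessThan_iff)
      with *[of j] show ?thesis by (simp add: P_def)
    qed
    from shift_graph_incomparable_extension[OF \<open>x \<noteq> 0\<close> _ this]
    obtain k N where "15 \<le> k" "2 * k + 2 \<le> N" "\<forall>(l, L) \<in> s ` {..<i}.
           \<not> tension_le TYPE('m) (shift_graph k N) (shift_graph l L) \<and>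
           \<not> tension_le TYPE('m) (shift_graph l L) (shift_graph k N)"
      by blast
    then have "P s i (k, N)" by (auto simp: P_def G_def split: prod.splits)
    then show "\<exists>r. P s i r" ..
  qed (auto simp: P_def)
  then obtain s where s: "\<And>i. P s i (s i)" by blast
  show ?thesis
  proof (intro exI[of _ "G \<circ> s"] conjI allI impI)
    fix i j :: nat
    show "finite_loopless_digraph ((G \<circ> s) i)" "chromatic_number ((G \<circ> s) i) \<le> 3"
      by (simp_all add: G_def case_prod_beta finite_loopless_shift_graph chromatic_number_shift_graph)
    assume "i \<noteq> j"
    then show "\<not> tension_le TYPE('m) ((G \<circ> s) i) ((G \<circ> s) j)"
      using s[of i] s[of j] by (cases "i < j") (auto simp: P_def)
  qed
qed

end
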